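(* Let $S$ be a finite set with $|S|=n$. Then: (1) $\min_{f}|\mathcal{C}(f)|=n$, the minimum being over all permutations $f$ of $S$; (2) for a permutation $f$ of $S$, $|\mathcal{C}(f)|=n$ if and only if $\Gamma(f)\simeq Z_n$ or $\Gamma(f)\simeq Z_1\cup Z_{n-1}$.
   Context: $\mathcal{C}(f)=\{g:S\to S\mid fg=gf\}$ is the set of all functions (not necessarily bijective) commuting with $f$. The functional graph $\Gamma(f)$ has vertex set $S$ and edges $[s,f(s)]$, $s\in S$. $Z_k$ denotes the directed cycle on $k$ vertices ($Z_1$ is a single vertex with a loop), and $\cup$ denotes disjoint union of graphs.
   Formalization: S is assumed non-empty (for n=0, |C(f)|=1, not 0), and for n=2 the alternative Γ(f)≃Z_1∪Z_{n-1} is dropped, since the identity on two points has graph Z_1∪Z_1 but commutes with all 4 self-maps. *)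

theory Defs
  imports
    "HOL-Library.FuncSet"
    "HOL-Combinatorics.Permutations"
    "Graph_Theory.Graph_Theory"
begin

text \<open>
  Self-maps of \<open>S\<close> are represented extensionally (value \<open>undefined\<close> outside \<open>S\<close>), so that
  \<open>card (commutants S f)\<close> counts functions \<open>S \<rightarrow> S\<close>. Only the values of \<open>f\<close> on \<open>S\<close> matter.
\<close>

definition commutants :: "'a set \<Rightarrow> ('a \<Rightarrow> 'a) \<Rightarrow> ('a \<Rightarrow> 'a) set" where
  "commutants S f = {g \<in> S \<rightarrow>\<^sub>E S. \<forall>s\<in>S. f (g s) = g (f s)}"

definition functional_graph :: "'a set \<Rightarrow> ('a \<Rightarrow> 'a) \<Rightarrow> 'a pair_pre_digraph" where
  "functional_graph S f = \<lparr> pverts = S, parcs = {(s, f s) | s. s \<in> S} \<rparr>"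

text \<open>\<open>directed_cycle 1\<close> is a single vertex with a loop; \<open>directed_cycle 0\<close> is the empty graph.\<close>

definition directed_cycle :: "nat \<Rightarrow> nat pair_pre_digraph" where
  "directed_cycle k = \<lparr> pverts = {..<k}, parcs = {(i, Suc i mod k) | i. i < k} \<rparr>"

definition disjoint_union ::
    "'a pair_pre_digraph \<Rightarrow> 'b pair_pre_digraph \<Rightarrow> ('a + 'b) pair_pre_digraph" where
  "disjoint_union G H =
    \<lparr> pverts = pverts G <+> pverts H,
      parcs = map_prod Inl Inl ` parcs G \<union> map_prod Inr Inr ` parcs H \<rparr>"

end

theory Submission
  imports Defs "HOL-Combinatorics.Orbits" "HOL-Combinatorics.Cycles"
begin

text \<open>
  A map commuting with a permutation \<open>f\<close> is determined by its values on a set \<open>R\<close> of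
  representatives of the orbits of \<open>f\<close>, and the value at \<open>r\<close> may be any point whose period
  divides the period of \<open>r\<close>. Writing \<open>p r\<close> for the period of \<open>r\<close> and \<open>a r\<close> for the number of
  admissible values at \<open>r\<close>, the number of commuting maps is therefore the product of the \<open>a r\<close>
  (\<open>card_commutants\<close>), whereas \<open>card S\<close> is the sum of the \<open>p r\<close> (\<open>card_eq_sum_periods\<close>). All points
  in the orbit of \<open>r\<close> are admissible at \<open>r\<close>, so \<open>p r \<le> a r\<close>.

  If every \<open>a r\<close> is at least 2, then the product of the \<open>a r\<close> is at least their sum, hence at
  least \<open>card S\<close>. With two or more orbits equality would force \<open>p r = a r = 2\<close> for every \<open>r\<close>; but
  two orbits of the same length make each \<open>a r\<close> at least 4. So equality leaves a single cycle. If some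
  \<open>a x\<close> is 1, then \<open>x\<close> is the only fixed point of \<open>f\<close> and contributes the factor 1. The point \<open>x\<close>
  is admissible everywhere, so \<open>a r \<ge> p r + 1\<close> for the other orbits, and the same comparison of
  product and sum gives at least \<open>card S\<close>, with equality only if there is at most one further orbit.

  Conversely, a single cycle on \<open>n\<close> points gives the one factor \<open>n\<close>, and a fixed point together with a
  cycle of length \<open>n - 1 \<noteq> 1\<close> gives the factors 1 and \<open>n\<close>. Since a cyclic permutation of \<open>S\<close> exists,
  the bound \<open>card S\<close> is attained.

  An isomorphism of functional graphs is a bijection conjugating one map to the other
  (\<open>digraph_iso_functional_graph_iff\<close>), which translates the two extremal orbit structures into
  the two graphs.
\<close>

section \<open>Periods and orbits\<close>

lemma card_orbit_eq_least_power:
  assumes "permutation f"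
  shows "card (orbit f x) = least_power f x"
proof -
  have "orbit f x = set (support f x)"
    using orbit_altdef_bounded[OF least_power_of_permutation[OF assms, of x]] by auto
  then show ?thesis
    using cycle_of_permutation[OF assms, of x] distinct_card[of "support f x"] by simp
qed

lemma least_power_eq_1_iff:
  assumes "permutation f"
  shows "least_power f x = 1 \<longleftrightarrow> f x = x"
  using least_power_dvd[OF assms, of x 1] by simp

lemma least_power_orbit:
  assumes "permutation f" "y \<in> orbit f x"
  shows "least_power f y = least_power f x"
  using orbit_cyclic_eq3[OF cyclic_on_orbit'[OF assms(1)] assms(2)]
  by (metis assms(1) card_orbit_eq_least_power)

text \<open>
  This is what makes \<open>f\<^sup>i x \<mapsto> f\<^sup>i y\<close> a well-defined map on the orbit of \<open>x\<close>.
\<close>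

lemma funpow_eq_if_least_power_dvd:
  assumes f: "permutation f" and dvd: "least_power f y dvd least_power f x"
    and eq: "(f ^^ i) x = (f ^^ j) x"
  shows "(f ^^ i) y = (f ^^ j) y"
proof -
  have le: "(f ^^ i) y = (f ^^ j) y" if "i \<le> j" "(f ^^ i) x = (f ^^ j) x" for i j
  proof -
    have "inj f"
      using f permutation_bijective bij_is_inj by blast
    then have "(f ^^ (j - i)) x = x"
      using that by (intro funpow_diff)
    then have "least_power f x dvd j - i"
      by (rule least_power_minimal)
    then have "(f ^^ (j - i)) y = y"
      using dvd_trans[OF dvd] least_power_dvd[OF f, of y "j - i"] by blast
    then have "(f ^^ (i + (j - i))) y = (f ^^ i) y"
      by (simp add: funpow_add)
    then show ?thesis
      using that(1) by simp
  qed
  show ?thesis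
  proof (cases "i \<le> j")
    case True
    then show ?thesis
      using eq by (rule le)
  next
    case False
    then have "j \<le> i"
      by simp
    from le[OF this eq[symmetric]] show ?thesis
      by (rule sym)
  qed
qed

definition orbit_transversal :: "('a \<Rightarrow> 'a) \<Rightarrow> 'a set \<Rightarrow> 'a set \<Rightarrow> bool" where
  "orbit_transversal f S R \<longleftrightarrow> R \<subseteq> S \<and> bij_betw (orbit f) R (orbit f ` S)"

lemma orbit_transversal_exists: "\<exists>R. orbit_transversal f S R"
proof -
  obtain R where "R \<subseteq> S" "inj_on (orbit f) R" "orbit f ` S = orbit f ` R"
    using subset_image_inj[THEN iffD1, OF subset_refl[of "orbit f ` S"]] by (elim exE conjE)
  then have "orbit_transversal f S R"
    by (simp add: orbit_transversal_def bij_betw_def)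
  then show ?thesis ..
qed

lemma orbit_transversal_cover:
  assumes "permutation f" "orbit_transversal f S R" "s \<in> S"
  obtains r where "r \<in> R" "s \<in> orbit f r"
proof -
  have "orbit f s \<in> orbit f ` R"
    using assms unfolding orbit_transversal_def bij_betw_def by auto
  then show ?thesis
    using permutation_self_in_orbit[OF assms(1), of s] that by auto
qed

lemma orbit_transversal_disjoint:
  assumes f: "permutation f" and R: "orbit_transversal f S R"
    and "r \<in> R" "r' \<in> R" "s \<in> orbit f r" "s \<in> orbit f r'"
  shows "r = r'"
proof -
  have "orbit f r = orbit f r'"
    using assms(5,6) orbit_cyclic_eq3[OF cyclic_on_orbit'[OF f]] by metis
  then show ?thesis
    using R assms(3,4) unfolding orbit_transversal_def bij_betw_def by (auto dest: inj_onD)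
qed

lemma card_eq_sum_periods:
  assumes fin: "finite S" and perm: "f permutes S" and R: "orbit_transversal f S R"
  shows "card S = (\<Sum>r\<in>R. least_power f r)"
proof -
  have f: "permutation f"
    using fin perm permutation_permutes by blast
  have RS: "R \<subseteq> S"
    using R by (simp add: orbit_transversal_def)
  have S: "S = (\<Union>r\<in>R. orbit f r)"
  proof
    show "S \<subseteq> (\<Union>r\<in>R. orbit f r)"
    proof
      fix s
      assume s: "s \<in> S"
      obtain r where "r \<in> R" "s \<in> orbit f r"
        using orbit_transversal_cover[OF f R s] .
      then show "s \<in> (\<Union>r\<in>R. orbit f r)"
        by blast
    qed
    show "(\<Union>r\<in>R. orbit f r) \<subseteq> S"
      using permutes_orbit_subset[OF perm subsetD[OF RS]] by blast
  qed
  have "card (\<Union>r\<in>R. orbit f r) = (\<Sum>r\<in>R. card (orbit f r))"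
  proof (rule card_UN_disjoint)
    show "finite R"
      using RS fin finite_subset by blast
    show "\<forall>r\<in>R. finite (orbit f r)"
      using finite_orbit permutation_self_in_orbit[OF f] by metis
    show "\<forall>r\<in>R. \<forall>r'\<in>R. r \<noteq> r' \<longrightarrow> orbit f r \<inter> orbit f r' = {}"
      using orbit_transversal_disjoint[OF f R] by blast
  qed
  then show ?thesis
    using S card_orbit_eq_least_power[OF f] by simp
qed

section \<open>Counting commuting maps\<close>

text \<open>
  A commuting map satisfies \<open>f\<^sup>i (g x) = g (f\<^sup>i x)\<close>, so the period of \<open>g x\<close> divides that of \<open>x\<close>.
\<close>

definition admissible :: "('a \<Rightarrow> 'a) \<Rightarrow> 'a set \<Rightarrow> 'a \<Rightarrow> 'a set" where
  "admissible f S x = {s \<in> S. least_power f s dvd least_power f x}"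

lemma commutants_funpow:
  assumes "f permutes S" "g \<in> commutants S f" "s \<in> S"
  shows "g ((f ^^ i) s) = (f ^^ i) (g s)"
proof (induction i)
  case (Suc i)
  have "(f ^^ i) s \<in> S"
    using assms(1,3) by (induction i) (auto simp: permutes_in_image)
  then have "f (g ((f ^^ i) s)) = g (f ((f ^^ i) s))"
    using assms(2) by (auto simp: commutants_def)
  with Suc show ?case
    by simp
qed simp

lemma commutants_admissible:
  assumes "finite S" "f permutes S" "g \<in> commutants S f" "s \<in> S"
  shows "g s \<in> admissible f S s"
proof -
  have f: "permutation f"
    using assms permutation_permutes by blast
  have "(f ^^ least_power f s) (g s) = g s"
    using commutants_funpow[OF assms(2-4)] least_power_of_permutation(1)[OF f] by metis
  then show ?thesis
    using assms(3,4) least_power_dvd[OF f] unfolding admissible_def commutants_def by auto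
qed

text \<open>
  Values prescribed at the representatives extend along the orbits: the point \<open>f\<^sup>i r\<close> must
  be sent to \<open>f\<^sup>i (h r)\<close>, and admissibility makes this independent of the choice of \<open>i\<close>.
\<close>

lemma commutants_extend:
  assumes fin: "finite S" and perm: "f permutes S" and R: "orbit_transversal f S R"
    and h: "h \<in> (\<Pi>\<^sub>E r\<in>R. admissible f S r)"
  obtains g where "g \<in> commutants S f" "restrict g R = h"
proof -
  have f: "permutation f"
    using fin perm permutation_permutes by blast
  have RS: "R \<subseteq> S"
    using R by (simp add: orbit_transversal_def)
  have hS: "h r \<in> S" and hdvd: "least_power f (h r) dvd least_power f r" if "r \<in> R" for r
    using h that by (auto simp: admissible_def PiE_iff)
  have inS: "(f ^^ i) s \<in> S" if "s \<in> S" for i s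
    using that perm by (induction i) (auto simp: permutes_in_image)
  define g where "g = (\<lambda>s\<in>S. SOME t. \<exists>r\<in>R. \<exists>i. s = (f ^^ i) r \<and> t = (f ^^ i) (h r))"
  have g: "g ((f ^^ i) r) = (f ^^ i) (h r)" if r: "r \<in> R" for r i
  proof -
    have "t = (f ^^ i) (h r)"
      if r': "r' \<in> R" "(f ^^ i) r = (f ^^ j) r'" "t = (f ^^ j) (h r')" for t r' j
    proof -
      have "(f ^^ i) r \<in> orbit f r" "(f ^^ j) r' \<in> orbit f r'"
        by (auto simp: funpow_in_orbit permutation_self_in_orbit[OF f])
      then have "r' = r"
        using orbit_transversal_disjoint[OF f R] r r'(1,2) by metis
      then show ?thesis
        using r'(2,3) funpow_eq_if_least_power_dvd[OF f hdvd[OF r], of i j] by simp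
    qed
    then have "(SOME t. \<exists>r'\<in>R. \<exists>j. (f ^^ i) r = (f ^^ j) r' \<and> t = (f ^^ j) (h r')) = (f ^^ i) (h r)"
      using r by (intro some_equality) blast+
    then show ?thesis
      using inS r RS by (auto simp: g_def)
  qed
  have points: "\<exists>r\<in>R. \<exists>i. s = (f ^^ i) r" if s: "s \<in> S" for s
  proof -
    obtain r where "r \<in> R" "s \<in> orbit f r"
      using orbit_transversal_cover[OF f R s] .
    then show ?thesis
      by (auto simp: orbit_altdef)
  qed
  have "g s \<in> S \<and> f (g s) = g (f s)" if sS: "s \<in> S" for s
  proof -
    obtain r i where r: "r \<in> R" and s: "s = (f ^^ i) r"
      using points[OF sS] by blast
    have "g (f s) = (f ^^ Suc i) (h r)"
      using g[OF r, of "Suc i"] s by simp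
    moreover have "g s = (f ^^ i) (h r)"
      using g[OF r, of i] s by simp
    ultimately show ?thesis
      using inS[OF hS[OF r]] by simp
  qed
  then have "g \<in> commutants S f"
    unfolding commutants_def by (auto simp: g_def)
  moreover have "restrict g R = h"
  proof
    fix r
    show "restrict g R r = h r"
      using g[of r 0] PiE_arb[OF h, of r] by (cases "r \<in> R") simp_all
  qed
  ultimately show ?thesis
    using that by blast
qed

text \<open>Restriction to the representatives is a bijection onto the families of admissible values.\<close>

lemma card_commutants:
  assumes fin: "finite S" and perm: "f permutes S" and R: "orbit_transversal f S R"
  shows "card (commutants S f) = (\<Prod>r\<in>R. card (admissible f S r))"
proof -
  have f: "permutation f"
    using fin perm permutation_permutes by blast
  have RS: "R \<subseteq> S"
    using R by (simp add: orbit_transversal_def)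
  have "bij_betw (\<lambda>g. restrict g R) (commutants S f) (\<Pi>\<^sub>E r\<in>R. admissible f S r)"
    unfolding bij_betw_def
  proof
    show "inj_on (\<lambda>g. restrict g R) (commutants S f)"
    proof (rule inj_onI)
      fix g h
      assume g: "g \<in> commutants S f" and h: "h \<in> commutants S f"
        and eq: "restrict g R = restrict h R"
      have eqR: "g r = h r" if "r \<in> R" for r
        using fun_cong[OF eq, of r] that by simp
      have "g s = h s" if s: "s \<in> S" for s
      proof -
        obtain r where r: "r \<in> R" "s \<in> orbit f r"
          using orbit_transversal_cover[OF f R s] .
        then obtain i where "s = (f ^^ i) r"
          by (auto simp: orbit_altdef)
        then show ?thesis
          using commutants_funpow[OF perm g, of r i] commutants_funpow[OF perm h, of r i]
            eqR[OF r(1)] subsetD[OF RS r(1)] by simp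
      qed
      moreover have "g \<in> S \<rightarrow>\<^sub>E S" "h \<in> S \<rightarrow>\<^sub>E S"
        using g h by (simp_all add: commutants_def)
      ultimately show "g = h"
        by (metis PiE_ext)
    qed
    show "(\<lambda>g. restrict g R) ` commutants S f = (\<Pi>\<^sub>E r\<in>R. admissible f S r)"
    proof
      show "(\<lambda>g. restrict g R) ` commutants S f \<subseteq> (\<Pi>\<^sub>E r\<in>R. admissible f S r)"
        using commutants_admissible[OF fin perm _ subsetD[OF RS]] by auto
      show "(\<Pi>\<^sub>E r\<in>R. admissible f S r) \<subseteq> (\<lambda>g. restrict g R) ` commutants S f"
      proof
        fix h
        assume h: "h \<in> (\<Pi>\<^sub>E r\<in>R. admissible f S r)"
        obtain g where "g \<in> commutants S f" "restrict g R = h"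
          using commutants_extend[OF fin perm R h] .
        then show "h \<in> (\<lambda>g. restrict g R) ` commutants S f"
          by blast
      qed
    qed
  qed
  then have "card (commutants S f) = card (\<Pi>\<^sub>E r\<in>R. admissible f S r)"
    by (rule bij_betw_same_card)
  then show ?thesis
    by (simp add: card_PiE finite_subset[OF RS fin])
qed

section \<open>The minimal number of commuting maps\<close>

text \<open>
  The comparison rests on \<open>x * y = x + y + ((x - 1) * (y - 1) - 1)\<close>, applied with \<open>y\<close> the product of
  the remaining factors; for \<open>x, y \<ge> 2\<close> the correction vanishes only at \<open>x = y = 2\<close>.
\<close>

lemma sum_le_prod_ge_2:
  fixes a :: "'i \<Rightarrow> nat"
  assumes "finite I" "I \<noteq> {}" "\<And>i. i \<in> I \<Longrightarrow> 2 \<le> a i"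
  shows "sum a I \<le> prod a I \<and> 2 \<le> prod a I \<and>
    (sum a I = prod a I \<longrightarrow> card I = 1 \<or> (\<forall>i\<in>I. a i = 2))"
  using assms
proof (induction I rule: finite_ne_induct)
  case (insert x F)
  define P where "P = prod a F"
  define s where "s = sum a F"
  have IH: "s \<le> P" "2 \<le> P" and x: "2 \<le> a x"
    using insert by (auto simp: P_def s_def)
  obtain b c where bc: "a x = b + 2" "P = c + 2"
    using x IH(2) by (metis add.commute le_Suc_ex)
  have sums: "sum a (insert x F) = a x + s" "prod a (insert x F) = a x * P"
    using insert by (simp_all add: P_def s_def)
  have "a x * P = a x + P + (b * c + b + c)"
    using bc by (simp add: algebra_simps)
  moreover have "\<forall>i\<in>F. a i = 2" if "P = 2"
  proof
    fix i
    assume i: "i \<in> F"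
    have "a i \<le> P"
      using i insert.hyps(1) \<open>P = 2\<close> unfolding P_def
      by (metis dvd_imp_le dvd_prodI pos2)
    then show "a i = 2"
      using that insert.prems[of i] i by simp
  qed
  ultimately show ?case
    using IH x bc sums by auto
qed simp

lemma card_admissible_ge:
  assumes "finite S" "f permutes S" "r \<in> S"
  shows "least_power f r \<le> card (admissible f S r)"
proof -
  have f: "permutation f"
    using assms permutation_permutes by blast
  have "orbit f r \<subseteq> admissible f S r"
    using permutes_orbit_subset[OF assms(2,3)] least_power_orbit[OF f]
    by (fastforce simp: admissible_def)
  then show ?thesis
    using card_mono[of "admissible f S r" "orbit f r"] assms(1) card_orbit_eq_least_power[OF f]
    by (simp add: admissible_def)
qed

text \<open>
  Every gain over the trivial bound comes from a second orbit whose length divides that of the first.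
\<close>

lemma card_admissible_ge_add:
  assumes "finite S" "f permutes S" "r \<in> S" "q \<in> S" "q \<notin> orbit f r"
    and dvd: "least_power f q dvd least_power f r"
  shows "least_power f r + least_power f q \<le> card (admissible f S r)"
proof -
  have f: "permutation f"
    using assms permutation_permutes by blast
  have disj: "orbit f r \<inter> orbit f q = {}"
    using assms(5) permutation_self_in_orbit[OF f] orbit_cyclic_eq3[OF cyclic_on_orbit'[OF f]]
    by (metis disjoint_iff)
  have fin: "finite (orbit f x)" for x
    using finite_orbit permutation_self_in_orbit[OF f] by metis
  have "orbit f r \<union> orbit f q \<subseteq> admissible f S r"
    using permutes_orbit_subset[OF assms(2)] assms(3,4) least_power_orbit[OF f] dvd
    by (fastforce simp: admissible_def)
  then have "card (orbit f r \<union> orbit f q) \<le> card (admissible f S r)"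
    by (rule card_mono[rotated]) (simp add: admissible_def assms(1))
  then show ?thesis
    using card_Un_disjoint[OF fin fin disj] card_orbit_eq_least_power[OF f] by simp
qed

text \<open>
  Two points must be excluded from the second alternative: there it describes the identity, with
  which all four self-maps commute.
\<close>

definition minimal_orbit_structure :: "'a set \<Rightarrow> ('a \<Rightarrow> 'a) \<Rightarrow> bool" where
  "minimal_orbit_structure S f \<longleftrightarrow> cyclic_on f S \<or>
    (card S \<noteq> 2 \<and> (\<exists>x\<in>S. f x = x \<and> cyclic_on f (S - {x})))"

lemma cyclic_on_if_transversal_singleton:
  assumes "permutation f" "f permutes S" "orbit_transversal f S {r}"
  shows "cyclic_on f S"
proof -
  have "r \<in> S"
    using assms(3) by (simp add: orbit_transversal_def)
  then have "S = orbit f r"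
    using permutes_orbit_subset[OF assms(2)] orbit_transversal_cover[OF assms(1,3)] by blast
  then show ?thesis
    using cyclic_on_orbit'[OF assms(1)] by metis
qed

text \<open>
  Equality makes both \<open>\<Sum> p \<le> \<Sum> a\<close> and \<open>\<Sum> a \<le> \<Prod> a\<close> sharp. With several orbits the second forces
  \<open>a = 2\<close> throughout and the first then \<open>p = 2\<close>, but orbits of equal length are admissible for
  each other.
\<close>

lemma card_le_card_commutants_if_admissible_ge_2:
  assumes fin: "finite S" and ne: "S \<noteq> {}" and perm: "f permutes S"
    and R: "orbit_transversal f S R"
    and two: "\<And>r. r \<in> R \<Longrightarrow> 2 \<le> card (admissible f S r)"
  shows "card S \<le> card (commutants S f) \<and>
    (card (commutants S f) = card S \<longrightarrow> cyclic_on f S)"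
proof -
  have f: "permutation f"
    using fin perm permutation_permutes by blast
  have RS: "R \<subseteq> S"
    using R by (simp add: orbit_transversal_def)
  have finR: "finite R"
    using RS fin finite_subset by blast
  have neR: "R \<noteq> {}"
    using ne orbit_transversal_cover[OF f R] by blast
  define a where "a = (\<lambda>r. card (admissible f S r))"
  have C: "card (commutants S f) = prod a R"
    using card_commutants[OF fin perm R] by (simp add: a_def)
  have S: "card S = (\<Sum>r\<in>R. least_power f r)"
    by (rule card_eq_sum_periods[OF fin perm R])
  have pa: "least_power f r \<le> a r" if "r \<in> R" for r
    using card_admissible_ge[OF fin perm, of r] that RS by (auto simp: a_def)
  have le: "(\<Sum>r\<in>R. least_power f r) \<le> sum a R"
    using pa by (rule sum_mono)
  have prod: "sum a R \<le> prod a R" "sum a R = prod a R \<longrightarrow> card R = 1 \<or> (\<forall>r\<in>R. a r = 2)"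
    using sum_le_prod_ge_2[OF finR neR, of a] two by (auto simp: a_def)
  have "cyclic_on f S" if eq: "card (commutants S f) = card S"
  proof -
    have sums: "(\<Sum>r\<in>R. least_power f r) = sum a R" "sum a R = prod a R"
      using eq C S le prod(1) by simp_all
    have pa_eq: "least_power f r = a r" if "r \<in> R" for r
      using sum_mono_inv[OF sums(1) pa that finR] .
    have "card R = 1"
    proof (rule ccontr)
      assume "card R \<noteq> 1"
      then have all2: "\<And>r. r \<in> R \<Longrightarrow> a r = 2"
        using prod(2) sums(2) by blast
      obtain r where r: "r \<in> R"
        using neR by blast
      moreover have "R \<noteq> {r}"
        using \<open>card R \<noteq> 1\<close> by auto
      ultimately obtain q where q: "q \<in> R" "q \<noteq> r"
        by blast
      have "q \<notin> orbit f r"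
        using orbit_transversal_disjoint[OF f R q(1) r permutation_self_in_orbit[OF f]] q(2) by blast
      then have "2 + 2 \<le> a r"
        using card_admissible_ge_add[OF fin perm, of r q] r q RS all2 pa_eq
        unfolding a_def by fastforce
      then show False
        using all2[OF r] by simp
    qed
    then obtain r where "R = {r}"
      using card_1_singletonE by blast
    then show ?thesis
      using cyclic_on_if_transversal_singleton[OF f perm] R by blast
  qed
  then show ?thesis
    using C S le prod(1) by simp
qed

text \<open>
  Here \<open>x\<close> is the unique fixed point. It contributes 1 to \<open>card S\<close> and the factor 1 to the product, and
  it adds one admissible value for each of the other orbits, which are collected in \<open>Q\<close>. So
  \<open>\<Prod> a \<ge> \<Sum> a \<ge> \<Sum> p + card Q\<close> over \<open>Q\<close>, and this exceeds \<open>card S\<close> as soon as \<open>card Q > 1\<close>.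
\<close>

lemma card_le_card_commutants_if_admissible_1:
  assumes fin: "finite S" and perm: "f permutes S"
    and R: "orbit_transversal f S R"
    and x: "x \<in> R" and one: "card (admissible f S x) \<le> 1"
  shows "card S \<le> card (commutants S f) \<and>
    (card (commutants S f) = card S \<longrightarrow> minimal_orbit_structure S f)"
proof -
  have f: "permutation f"
    using fin perm permutation_permutes by blast
  have RS: "R \<subseteq> S"
    using R by (simp add: orbit_transversal_def)
  have finR: "finite R"
    using RS fin finite_subset by blast
  define a where "a = (\<lambda>r. card (admissible f S r))"
  have pos: "0 < least_power f r" for r
    using least_power_of_permutation(2)[OF f] .
  have xS: "x \<in> S"
    using x RS by blast
  have px: "least_power f x = 1"
    using card_admissible_ge[OF fin perm xS] one pos[of x] by linarith
  then have fx: "f x = x"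
    using least_power_eq_1_iff[OF f] by blast
  have ax: "a x = 1"
    using card_admissible_ge[OF fin perm xS] one px by (simp add: a_def)
  have notfixed: "f s \<noteq> s" if "s \<in> S" "s \<noteq> x" for s
  proof
    assume "f s = s"
    then have "least_power f s = 1"
      using least_power_eq_1_iff[OF f] by blast
    then have "{s, x} \<subseteq> admissible f S x"
      using that(1) xS by (simp add: admissible_def)
    then have "card {s, x} \<le> a x"
      unfolding a_def using fin by (intro card_mono) (auto simp: admissible_def)
    then show False
      using ax that(2) by simp
  qed
  define Q where "Q = R - {x}"
  have finQ: "finite Q"
    using finR by (simp add: Q_def)
  have RQ: "R = insert x Q" "x \<notin> Q"
    using x by (auto simp: Q_def)
  have C: "card (commutants S f) = prod a Q"
    using card_commutants[OF fin perm R] RQ finQ ax by (simp add: a_def)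
  have S: "card S = 1 + (\<Sum>r\<in>Q. least_power f r)"
    using card_eq_sum_periods[OF fin perm R] RQ finQ px by simp
  show ?thesis
  proof (cases "Q = {}")
    case True
    then show ?thesis
      using C S cyclic_on_if_transversal_singleton[OF f perm, of x] R RQ(1)
      by (simp add: minimal_orbit_structure_def)
  next
    case False
    have pa: "least_power f r + 1 \<le> a r" if r: "r \<in> Q" for r
    proof -
      have "r \<in> R" "r \<noteq> x"
        using r by (auto simp: Q_def)
      then have "x \<notin> orbit f r"
        using orbit_transversal_disjoint[OF f R x \<open>r \<in> R\<close> permutation_self_in_orbit[OF f]] by blast
      then show ?thesis
        using card_admissible_ge_add[OF fin perm, of r x] \<open>r \<in> R\<close> RS xS px by (auto simp: a_def)
    qed
    have "2 \<le> a r" if "r \<in> Q" for r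
      using pa[OF that] pos[of r] by linarith
    then have prod: "sum a Q \<le> prod a Q"
      using sum_le_prod_ge_2[OF finQ False, of a] by blast
    have "(\<Sum>r\<in>Q. least_power f r + 1) \<le> sum a Q"
      using pa by (rule sum_mono)
    then have le: "(\<Sum>r\<in>Q. least_power f r) + card Q \<le> sum a Q"
      by (simp add: sum_Suc)
    have "card Q \<ge> 1"
      using False finQ by (simp add: Suc_leI card_gt_0_iff)
    then have "card S \<le> card (commutants S f)"
      using C S prod le by linarith
    moreover have "minimal_orbit_structure S f" if "card (commutants S f) = card S"
    proof -
      have "card Q = 1"
        using that C S prod le \<open>card Q \<ge> 1\<close> by linarith
      then obtain y where y: "Q = {y}"
        using card_1_singletonE by blast
      have yS: "y \<in> S" "y \<noteq> x" "y \<in> R"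
        using y RS RQ by auto
      have "orbit f x = {x}"
        using fx by (simp add: orbit_eq_singleton_iff)
      then have "S - {x} \<subseteq> orbit f y"
        using orbit_transversal_cover[OF f R] RQ(1) y by blast
      moreover have "x \<notin> orbit f y"
        using orbit_transversal_disjoint[OF f R x yS(3) permutation_self_in_orbit[OF f]] yS(2) by blast
      then have "orbit f y \<subseteq> S - {x}"
        using permutes_orbit_subset[OF perm yS(1)] by blast
      ultimately have "S - {x} = orbit f y"
        by blast
      then have "cyclic_on f (S - {x})"
        using cyclic_on_orbit'[OF f] by metis
      moreover have "card S \<noteq> 2"
        using S y notfixed[OF yS(1,2)] least_power_eq_1_iff[OF f, of y] by simp
      ultimately show ?thesis
        using fx xS by (auto simp: minimal_orbit_structure_def)
    qed
    ultimately show ?thesis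
      by blast
  qed
qed

lemma card_commutants_if_cyclic:
  assumes fin: "finite S" and perm: "f permutes S" and cyc: "cyclic_on f S"
  shows "card (commutants S f) = card S"
proof -
  have f: "permutation f"
    using fin perm permutation_permutes by blast
  have orb: "\<And>s. s \<in> S \<Longrightarrow> orbit f s = S"
    using orbit_cyclic_eq3[OF cyc] by blast
  obtain x where x: "x \<in> S"
    using cyc by (auto simp: cyclic_on_def)
  have "orbit_transversal f S {x}"
    using x orb by (auto simp: orbit_transversal_def bij_betw_def)
  moreover have "admissible f S x = S"
    using least_power_orbit[OF f, of _ x] orb[OF x] by (auto simp: admissible_def)
  ultimately show ?thesis
    using card_commutants[OF fin perm] by simp
qed

text \<open>
  The fixed point can only be sent to itself, because the other cycle does not have length 1; a point
  of the other cycle can be sent anywhere, because both orbit lengths divide its period.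
\<close>

lemma card_commutants_if_fixed_point_and_cyclic:
  assumes fin: "finite S" and perm: "f permutes S" and n: "card S \<noteq> 2"
    and x: "x \<in> S" and fx: "f x = x" and cyc: "cyclic_on f (S - {x})"
  shows "card (commutants S f) = card S"
proof -
  have f: "permutation f"
    using fin perm permutation_permutes by blast
  have orb: "\<And>s. s \<in> S - {x} \<Longrightarrow> orbit f s = S - {x}"
    using orbit_cyclic_eq3[OF cyc] by blast
  have orbx: "orbit f x = {x}"
    using fx by (simp add: orbit_eq_singleton_iff)
  have px: "least_power f x = 1"
    using fx least_power_eq_1_iff[OF f] by blast
  obtain y where y: "y \<in> S - {x}"
    using cyc by (auto simp: cyclic_on_def)
  have "card (S - {x}) \<noteq> 1"
    using n x fin by (simp add: card_Diff_singleton)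
  then have not1: "least_power f s \<noteq> 1" if "s \<in> S - {x}" for s
    using orb[OF that] card_orbit_eq_least_power[OF f, of s] by simp
  have "orbit f ` S = {{x}, S - {x}}"
    using orb orbx x y by (auto simp: image_iff)
  then have "orbit_transversal f S {x, y}"
    using x y orb orbx by (auto simp: orbit_transversal_def bij_betw_def)
  then have "card (commutants S f) = (\<Prod>r\<in>{x, y}. card (admissible f S r))"
    by (rule card_commutants[OF fin perm])
  then have "card (commutants S f) = card (admissible f S x) * card (admissible f S y)"
    using y by auto
  moreover have "admissible f S x = {x}"
    using x not1 px by (auto simp: admissible_def)
  moreover have "least_power f s dvd least_power f y" if "s \<in> S" for s
    using that px least_power_orbit[OF f, of s y] orb[OF y] by (cases "s = x") auto
  then have "admissible f S y = S"
    by (auto simp: admissible_def)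
  ultimately show ?thesis
    by simp
qed

theorem card_commutants_ge_and_eq_iff:
  assumes fin: "finite S" and ne: "S \<noteq> {}" and perm: "f permutes S"
  shows "card S \<le> card (commutants S f)"
    and "card (commutants S f) = card S \<longleftrightarrow> minimal_orbit_structure S f"
proof -
  obtain R where R: "orbit_transversal f S R"
    using orbit_transversal_exists by blast
  have main: "card S \<le> card (commutants S f) \<and>
    (card (commutants S f) = card S \<longrightarrow> minimal_orbit_structure S f)"
  proof (cases "\<exists>x\<in>R. card (admissible f S x) \<le> 1")
    case True
    then show ?thesis
      using card_le_card_commutants_if_admissible_1[OF fin perm R] by blast
  next
    case False
    then have "\<And>r. r \<in> R \<Longrightarrow> 2 \<le> card (admissible f S r)"
      by force
    then show ?thesis
      using card_le_card_commutants_if_admissible_ge_2[OF fin ne perm R]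
      by (simp add: minimal_orbit_structure_def)
  qed
  then show "card S \<le> card (commutants S f)"
    by blast
  show "card (commutants S f) = card S \<longleftrightarrow> minimal_orbit_structure S f"
    using main card_commutants_if_cyclic[OF fin perm]
      card_commutants_if_fixed_point_and_cyclic[OF fin perm]
    unfolding minimal_orbit_structure_def by blast
qed

section \<open>Isomorphism of functional graphs\<close>

text \<open>
  A vertex \<open>s\<close> has exactly one outgoing arc, namely \<open>(s, f s)\<close>, and the arcs of the target are
  determined by their ends; so the vertex part of an isomorphism carries all the information.
\<close>

lemma digraph_iso_functional_graph_iff:
  assumes f: "f \<in> S \<rightarrow> S"
  shows "digraph_iso (with_proj (functional_graph S f)) (with_proj (functional_graph T g)) \<longleftrightarrow>
    (\<exists>\<phi>. bij_betw \<phi> S T \<and> (\<forall>s\<in>S. \<phi> (f s) = g (\<phi> s)))" (is "digraph_iso ?G ?H \<longleftrightarrow> ?R")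
proof
  assume "digraph_iso ?G ?H"
  then obtain h where h: "pre_digraph.digraph_isomorphism ?G h" and H: "?H = app_iso h ?G"
    unfolding digraph_iso_def by blast
  have verts: "T = iso_verts h ` S"
    using arg_cong[OF H, of verts] by (simp add: functional_graph_def)
  have arcs: "{(t, g t) |t. t \<in> T} = iso_arcs h ` {(s, f s) |s. s \<in> S}"
    using arg_cong[OF H, of arcs] by (simp add: functional_graph_def)
  have ends: "iso_tail h = fst" "iso_head h = snd"
    using arg_cong[OF H, of tail] arg_cong[OF H, of head] by simp_all
  have "iso_verts h (f s) = g (iso_verts h s)" if s: "s \<in> S" for s
  proof -
    have "iso_verts h s = fst (iso_arcs h (s, f s)) \<and> iso_verts h (f s) = snd (iso_arcs h (s, f s))"
      using h s ends unfolding pre_digraph.digraph_isomorphism_def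
      by (auto simp: functional_graph_def)
    moreover have "iso_arcs h (s, f s) \<in> {(t, g t) |t. t \<in> T}"
      using arcs s by blast
    ultimately show ?thesis
      by auto
  qed
  moreover have "bij_betw (iso_verts h) S T"
    using h verts unfolding pre_digraph.digraph_isomorphism_def bij_betw_def
    by (auto simp: functional_graph_def)
  ultimately show ?R
    by blast
next
  assume ?R
  then obtain \<phi> where \<phi>: "bij_betw \<phi> S T" and comm: "\<And>s. s \<in> S \<Longrightarrow> \<phi> (f s) = g (\<phi> s)"
    by blast
  define h where "h = \<lparr>iso_verts = \<phi>, iso_arcs = map_prod \<phi> \<phi>, iso_head = snd, iso_tail = fst\<rparr>"
  have inj: "inj_on \<phi> S" and im: "\<phi> ` S = T"
    using \<phi> by (auto simp: bij_betw_def)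
  have "wf_digraph ?G"
    using f by unfold_locales (auto simp: functional_graph_def)
  moreover have "inj_on (map_prod \<phi> \<phi>) {(s, f s) |s. s \<in> S}"
    using inj by (auto simp: inj_on_def)
  ultimately have "pre_digraph.digraph_isomorphism ?G h"
    using inj unfolding pre_digraph.digraph_isomorphism_def
    by (auto simp: functional_graph_def h_def)
  moreover have "map_prod \<phi> \<phi> ` {(s, f s) |s. s \<in> S} = {(t, g t) |t. t \<in> T}"
    using im comm by (force simp: image_iff)
  then have "?H = app_iso h ?G"
    using im by (simp add: app_iso_def h_def with_proj_def functional_graph_def)
  ultimately show "digraph_iso ?G ?H"
    unfolding digraph_iso_def by blast
qed

lemma directed_cycle_eq_functional_graph:
  "directed_cycle k = functional_graph {..<k} (\<lambda>i. Suc i mod k)"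
  by (simp add: directed_cycle_def functional_graph_def)

lemma disjoint_union_functional_graph:
  "disjoint_union (functional_graph S f) (functional_graph T g) =
    functional_graph (S <+> T) (map_sum f g)"
  unfolding disjoint_union_def functional_graph_def by (force simp: image_iff)

lemma cyclic_on_Suc_mod:
  assumes "0 < k"
  shows "cyclic_on (\<lambda>i. Suc i mod k) {..<k}"
proof -
  have pow: "((\<lambda>i. Suc i mod k) ^^ m) 0 = m mod k" for m
    by (induction m) (simp_all add: mod_Suc_eq)
  have "orbit (\<lambda>i. Suc i mod k) 0 = {((\<lambda>i. Suc i mod k) ^^ m) 0 | m. m < k}"
    using assms by (intro orbit_altdef_bounded) (simp_all add: pow)
  then have "orbit (\<lambda>i. Suc i mod k) 0 = {..<k}"
    using assms by (auto simp: pow intro: mod_less[symmetric])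
  then show ?thesis
    using assms by (auto simp: cyclic_on_def)
qed

text \<open>
  The empty set is included because it occurs as the complement of the fixed point when \<open>S\<close> has
  a single element.
\<close>

lemma conjugate_Suc_mod_iff:
  assumes fin: "finite T" and perm: "permutation f" and f: "f \<in> T \<rightarrow> T"
  shows "(\<exists>\<phi>. bij_betw \<phi> T {..<card T} \<and> (\<forall>t\<in>T. \<phi> (f t) = Suc (\<phi> t) mod card T)) \<longleftrightarrow>
    T = {} \<or> cyclic_on f T" (is "?L \<longleftrightarrow> ?R")
proof
  assume ?L
  then obtain \<phi> where \<phi>: "bij_betw \<phi> T {..<card T}"
    and comm: "\<And>t. t \<in> T \<Longrightarrow> \<phi> (f t) = Suc (\<phi> t) mod card T"
    by blast
  define \<psi> where "\<psi> = inv_into T \<phi>"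
  have \<psi>: "\<psi> ` {..<card T} = T"
    unfolding \<psi>_def using \<phi> by (metis bij_betw_imp_surj_on bij_betw_inv_into)
  have "f (\<psi> i) = \<psi> (Suc i mod card T)" if i: "i \<in> {..<card T}" for i
  proof -
    have "\<psi> i \<in> T"
      using i \<psi> by blast
    then have "f (\<psi> i) \<in> T"
      using f by blast
    moreover have "\<phi> (\<psi> i) = i"
      unfolding \<psi>_def using \<phi> i by (metis bij_betw_inv_into_right)
    ultimately show ?thesis
      using comm[OF \<open>\<psi> i \<in> T\<close>] \<phi> unfolding \<psi>_def by (metis bij_betw_inv_into_left)
  qed
  then have "cyclic_on f T" if "T \<noteq> {}"
    using cyclic_on_image[OF cyclic_on_Suc_mod, of "card T" f \<psi>] that fin \<psi>
    by (simp add: card_gt_0_iff)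
  then show ?R
    by blast
next
  assume R: ?R
  show ?L
  proof (cases "T = {}")
    case True
    then show ?thesis
      by (simp add: bij_betw_def)
  next
    case False
    then have cyc: "cyclic_on f T"
      using R by blast
    then obtain x where x: "x \<in> T" "T = orbit f x"
      by (auto simp: cyclic_on_def)
    define k where "k = card T"
    have k: "k = least_power f x"
      using x(2) card_orbit_eq_least_power[OF perm] by (simp add: k_def)
    have kx: "(f ^^ k) x = x" "0 < k"
      using least_power_of_permutation[OF perm, of x] by (simp_all add: k)
    define \<psi> where "\<psi> = (\<lambda>i. (f ^^ i) x)"
    have im: "\<psi> ` {..<k} = T"
      using orbit_altdef_bounded[OF kx] x(2) by (auto simp: \<psi>_def)
    then have \<psi>: "bij_betw \<psi> {..<k} T"
      by (simp add: bij_betw_def eq_card_imp_inj_on k_def)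
    define \<phi> where "\<phi> = inv_into {..<k} \<psi>"
    have \<phi>: "bij_betw \<phi> T {..<k}"
      unfolding \<phi>_def using \<psi> by (rule bij_betw_inv_into)
    have "\<phi> (f t) = Suc (\<phi> t) mod k" if t: "t \<in> T" for t
    proof -
      obtain i where i: "i < k" "t = \<psi> i"
        using t im by auto
      have "f t = \<psi> (Suc i mod k)"
        using funpow_mod_eq[OF kx(1), of "Suc i"] i(2) by (simp add: \<psi>_def)
      then show ?thesis
        using i \<psi> kx(2) unfolding \<phi>_def
        by (metis bij_betw_inv_into_left lessThan_iff mod_less_divisor)
    qed
    then show ?thesis
      using \<phi> by (auto simp: k_def)
  qed
qed

lemma digraph_iso_directed_cycle_iff:
  assumes "finite S" "S \<noteq> {}" "f permutes S"
  shows "digraph_iso (with_proj (functional_graph S f)) (with_proj (directed_cycle (card S))) \<longleftrightarrow>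
    cyclic_on f S"
proof -
  have f: "permutation f" and fS: "f \<in> S \<rightarrow> S"
    using assms permutation_permutes by (auto simp: permutes_in_image)
  show ?thesis
    using conjugate_Suc_mod_iff[OF assms(1) f fS] assms(2)
    by (simp add: directed_cycle_eq_functional_graph digraph_iso_functional_graph_iff[OF fS])
qed

text \<open>
  The vertex \<open>Inl 0\<close> corresponds to the fixed point \<open>x\<close>, and deleting it on both sides leaves a conjugacy
  between \<open>f\<close> on \<open>S - {x}\<close> and the second cycle.
\<close>

lemma digraph_iso_fixed_point_cycle_iff:
  fixes S :: "'a set"
  assumes fin: "finite S" and perm: "f permutes S"
  shows "digraph_iso (with_proj (functional_graph S f))
      (with_proj (disjoint_union (directed_cycle 1) (directed_cycle (card S - 1)))) \<longleftrightarrow>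
    (\<exists>x\<in>S. f x = x \<and> (S = {x} \<or> cyclic_on f (S - {x})))" (is "?iso \<longleftrightarrow> ?R")
proof -
  have f: "permutation f" and fS: "f \<in> S \<rightarrow> S"
    using assms permutation_permutes by (auto simp: permutes_in_image)
  have closed: "f \<in> (S - {x}) \<rightarrow> (S - {x})" if "f x = x" for x
    using fS that permutes_inj[OF perm] by (auto dest: injD)
  define k where "k = card S - 1"
  define c where "c = map_sum (\<lambda>i::nat. Suc i mod 1) (\<lambda>i. Suc i mod k)"
  have "?iso \<longleftrightarrow>
    (\<exists>\<phi>. bij_betw \<phi> S ({..<1} <+> {..<k}) \<and> (\<forall>s\<in>S. \<phi> (f s) = c (\<phi> s)))"
    unfolding directed_cycle_eq_functional_graph disjoint_union_functional_graph
    by (simp add: digraph_iso_functional_graph_iff[OF fS] c_def k_def)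
  also have "\<dots> \<longleftrightarrow> (\<exists>x\<in>S. f x = x \<and> (\<exists>\<phi>. bij_betw \<phi> (S - {x}) {..<k} \<and>
      (\<forall>s\<in>S - {x}. \<phi> (f s) = Suc (\<phi> s) mod k)))" (is "?A \<longleftrightarrow> ?B")
  proof
    assume ?A
    then obtain \<phi> where \<phi>: "bij_betw \<phi> S ({..<1} <+> {..<k})"
      and comm: "\<And>s. s \<in> S \<Longrightarrow> \<phi> (f s) = c (\<phi> s)"
      by blast
    have inj: "inj_on \<phi> S" and im: "\<phi> ` S = {..<1} <+> {..<k}"
      using \<phi> by (auto simp: bij_betw_def)
    have "Inl 0 \<in> \<phi> ` S"
      using im by auto
    then obtain x where x: "x \<in> S" "\<phi> x = Inl 0"
      by auto
    have "\<phi> (f x) = \<phi> x"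
      using comm[OF x(1)] x(2) by (simp add: c_def)
    then have fx: "f x = x"
      using inj x(1) fS by (auto dest: inj_onD)
    have "\<phi> ` (S - {x}) = Inr ` {..<k}"
      using inj_on_image_set_diff[OF inj, of S "{x}"] im x by auto
    then have "bij_betw \<phi> (S - {x}) (Inr ` {..<k})"
      using inj by (auto simp: bij_betw_def intro: inj_on_subset)
    moreover have "bij_betw projr (Inr ` {..<k}) {..<k}"
      by (auto simp: bij_betw_def inj_on_def image_iff)
    ultimately have bij: "bij_betw (projr \<circ> \<phi>) (S - {x}) {..<k}"
      by (rule bij_betw_trans)
    have "(projr \<circ> \<phi>) (f s) = Suc ((projr \<circ> \<phi>) s) mod k" if s: "s \<in> S - {x}" for s
    proof -
      have "\<phi> s \<in> Inr ` {..<k}"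
        using s \<open>\<phi> ` (S - {x}) = Inr ` {..<k}\<close> by blast
      then show ?thesis
        using comm[of s] s by (auto simp: c_def)
    qed
    with bij fx x(1) show ?B
      by blast
  next
    assume ?B
    then obtain x \<phi> where x: "x \<in> S" "f x = x" and \<phi>: "bij_betw \<phi> (S - {x}) {..<k}"
      and comm: "\<And>s. s \<in> S - {x} \<Longrightarrow> \<phi> (f s) = Suc (\<phi> s) mod k"
      by blast
    define \<psi> :: "'a \<Rightarrow> nat + nat" where "\<psi> s = (if s = x then Inl 0 else Inr (\<phi> s))" for s
    have "inj_on \<psi> S"
      using \<phi> by (auto simp: \<psi>_def inj_on_def bij_betw_def)
    moreover have "\<psi> ` S = {..<1} <+> {..<k}"
    proof -
      have "\<psi> ` S = insert (Inl 0) (Inr ` \<phi> ` (S - {x}))"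
        using x(1) by (auto simp: \<psi>_def)
      then show ?thesis
        using \<phi> by (auto simp: bij_betw_def)
    qed
    moreover have "\<psi> (f s) = c (\<psi> s)" if s: "s \<in> S" for s
    proof (cases "s = x")
      case True
      then show ?thesis
        using x(2) by (simp add: \<psi>_def c_def)
    next
      case False
      then have "f s \<noteq> x"
        using closed[OF x(2)] s by blast
      then show ?thesis
        using False comm[of s] s by (simp add: \<psi>_def c_def)
    qed
    ultimately show ?A
      by (auto simp: bij_betw_def)
  qed
  also have "\<dots> \<longleftrightarrow> ?R"
  proof -
    have "(\<exists>\<phi>. bij_betw \<phi> (S - {x}) {..<k} \<and> (\<forall>s\<in>S - {x}. \<phi> (f s) = Suc (\<phi> s) mod k)) \<longleftrightarrow>
      S = {x} \<or> cyclic_on f (S - {x})" if x: "x \<in> S" "f x = x" for x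
    proof -
      have "card (S - {x}) = k"
        using x(1) by (simp add: k_def card_Diff_singleton)
      moreover have "S - {x} = {} \<longleftrightarrow> S = {x}"
        using x(1) by blast
      ultimately show ?thesis
        using conjugate_Suc_mod_iff[OF _ f closed[OF x(2)]] fin by simp
    qed
    then show ?thesis
      by blast
  qed
  finally show ?thesis .
qed

section \<open>The minimum and its characterisation\<close>

text \<open>Transport the successor modulo \<open>card S\<close> along an enumeration of \<open>S\<close>.\<close>

lemma cyclic_permutation_exists:
  assumes fin: "finite S" and ne: "S \<noteq> {}"
  obtains f where "f permutes S" "cyclic_on f S"
proof -
  define k where "k = card S"
  define c where "c i = Suc i mod k" for i
  have k: "0 < k"
    using fin ne by (simp add: k_def card_gt_0_iff)
  have cyc: "cyclic_on c {..<k}"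
    using cyclic_on_Suc_mod[OF k] by (simp add: c_def[abs_def])
  have "c ` {..<k} = {..<k}"
  proof
    show "c ` {..<k} \<subseteq> {..<k}"
      using k by (auto simp: c_def)
    show "{..<k} \<subseteq> c ` {..<k}"
    proof
      fix i
      assume i: "i \<in> {..<k}"
      show "i \<in> c ` {..<k}"
      proof (cases i)
        case 0
        then have "i = c (k - 1)"
          using k by (simp add: c_def)
        then show ?thesis
          using k by auto
      next
        case (Suc j)
        then show ?thesis
          using i by (auto simp: c_def image_iff intro!: bexI[of _ j])
      qed
    qed
  qed
  then have c: "bij_betw c {..<k} {..<k}"
    by (simp add: bij_betw_def eq_card_imp_inj_on)
  obtain \<phi> where \<phi>: "bij_betw \<phi> {..<k} S"
    using fin finite_same_card_bij[of "{..<k}" S] by (auto simp: k_def)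
  define f where "f s = (if s \<in> S then \<phi> (c (inv_into {..<k} \<phi> s)) else s)" for s
  have "bij_betw (\<phi> \<circ> c \<circ> inv_into {..<k} \<phi>) S S"
    by (rule bij_betw_trans[OF bij_betw_inv_into[OF \<phi>] bij_betw_trans[OF c \<phi>]])
  then have "bij_betw f S S"
    by (rule bij_betw_cong[THEN iffD1, rotated]) (simp add: f_def)
  then have "f permutes S"
    by (rule bij_imp_permutes) (simp add: f_def)
  moreover have "cyclic_on f (\<phi> ` {..<k})"
    using \<phi> by (intro cyclic_on_image[OF cyc]) (auto simp: f_def bij_betw_def)
  then have "cyclic_on f S"
    using \<phi> by (simp add: bij_betw_def)
  ultimately show ?thesis
    using that by blast
qed

theorem proposition2p22:
  fixes S :: "'a set" and n :: nat
  assumes "finite S" and "S \<noteq> {}" and "card S = n"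
  shows "(MIN f\<in>{f. f permutes S}. card (commutants S f)) = n \<and>
    (\<forall>f. f permutes S \<longrightarrow>
      (card (commutants S f) = n \<longleftrightarrow>
        digraph_iso (with_proj (functional_graph S f)) (with_proj (directed_cycle n)) \<or>
        (n \<noteq> 2 \<and>
         digraph_iso (with_proj (functional_graph S f))
           (with_proj (disjoint_union (directed_cycle 1) (directed_cycle (n - 1)))))))"
proof (intro conjI allI impI)
  obtain f where f: "f permutes S" "cyclic_on f S"
    using cyclic_permutation_exists[OF assms(1,2)] .
  show "(MIN f\<in>{f. f permutes S}. card (commutants S f)) = n"
  proof (rule Min_eqI)
    show "finite ((\<lambda>f. card (commutants S f)) ` {f. f permutes S})"
      using finite_permutations[OF assms(1)] by blast
    show "n \<le> m" if "m \<in> (\<lambda>f. card (commutants S f)) ` {f. f permutes S}" for m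
      using that card_commutants_ge_and_eq_iff(1)[OF assms(1,2)] assms(3) by auto
    show "n \<in> (\<lambda>f. card (commutants S f)) ` {f. f permutes S}"
      using f card_commutants_if_cyclic[OF assms(1) f] assms(3) by (auto simp: image_iff)
  qed
next
  fix f
  assume perm: "f permutes S"
  \<comment> \<open>On a single point, \<open>Z\<^sub>1 \<union> Z\<^sub>0\<close> is again the cycle \<open>Z\<^sub>1\<close>.\<close>
  have single: "cyclic_on f S" if "S = {x}" "f x = x" for x
    using that orbit_eq_singleton_iff[of f x] by (auto simp: cyclic_on_def)
  show "card (commutants S f) = n \<longleftrightarrow>
      digraph_iso (with_proj (functional_graph S f)) (with_proj (directed_cycle n)) \<or>
      (n \<noteq> 2 \<and>
       digraph_iso (with_proj (functional_graph S f))
         (with_proj (disjoint_union (directed_cycle 1) (directed_cycle (n - 1)))))"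
    using card_commutants_ge_and_eq_iff(2)[OF assms(1,2) perm] single
      digraph_iso_directed_cycle_iff[OF assms(1,2) perm]
      digraph_iso_fixed_point_cycle_iff[OF assms(1) perm]
    unfolding minimal_orbit_structure_def assms(3) by blast
qed

end
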